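(* Let $D \ge 1$, $\mathcal{B} = [0,1]^D$, let $\alpha : \mathcal{B} \to \mathbb{R}$ be a function (the acquisition function), and let $\xi : \mathcal{B} \to \mathbb{R}$ be a function (the sparsity penalty) that has a unique global minimizer $\mathbf{x}^s \in \mathcal{B}$. For $\lambda > 0$ define $\alpha_{\mathrm{ER}}(\mathbf{x};\lambda) = \alpha(\mathbf{x}) - \lambda\, \xi(\mathbf{x})$ for $\mathbf{x} \in \mathcal{B}$. Let $\theta \in \mathbb{R}$ and suppose that $\alpha(\mathbf{x}) = 0$ for every $\mathbf{x} \in \mathcal{B}$ with $\xi(\mathbf{x}) \le \theta$. Then, for every $\lambda > 0$, every maximizer $\mathbf{x}$ of $\alpha_{\mathrm{ER}}(\cdot\,;\lambda)$ over $\mathcal{B}$ satisfies $\xi(\mathbf{x}) > \theta$ or $\mathbf{x} = \mathbf{x}^s$.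
   Context: In Bayesian optimization, the next evaluation point in the search space $\mathcal{B}$ is chosen by maximizing an acquisition function $\alpha$. The penalty $\xi$ models sparsity (smaller values mean sparser), and $\mathbf{x}^s$ is the target point towards which solutions are regularized. The function $\alpha_{\mathrm{ER}}$ is called the acquisition function with external regularization. A maximizer of $\alpha_{\mathrm{ER}}(\cdot\,;\lambda)$ is a point $\mathbf{x} \in \mathcal{B}$ with $\alpha_{\mathrm{ER}}(\mathbf{x};\lambda) \ge \alpha_{\mathrm{ER}}(\mathbf{y};\lambda)$ for all $\mathbf{y} \in \mathcal{B}$. *)

theory Defs
  imports "HOL-Analysis.Analysis"
begin

(* The dimension D is CARD('n), which is at least 1 for every finite index type. *)
definition search_space :: "(real ^ 'n) set" where
  "search_space = {x. \<forall>i. 0 \<le> x $ i \<and> x $ i \<le> 1}"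

definition acq_ER :: "('a \<Rightarrow> real) \<Rightarrow> ('a \<Rightarrow> real) \<Rightarrow> real \<Rightarrow> 'a \<Rightarrow> real" where
  "acq_ER \<alpha> \<xi> l x = \<alpha> x - l * \<xi> x"

definition maximizer_on :: "'a set \<Rightarrow> ('a \<Rightarrow> real) \<Rightarrow> 'a \<Rightarrow> bool" where
  "maximizer_on S f x \<longleftrightarrow> x \<in> S \<and> (\<forall>y\<in>S. f x \<ge> f y)"

definition unique_minimizer_on :: "'a set \<Rightarrow> ('a \<Rightarrow> real) \<Rightarrow> 'a \<Rightarrow> bool" where
  "unique_minimizer_on S f x \<longleftrightarrow>
     is_arg_min f (\<lambda>y. y \<in> S) x \<and> (\<forall>z. is_arg_min f (\<lambda>y. y \<in> S) z \<longrightarrow> z = x)"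

end

theory Submission
  imports Defs
begin

text \<open>On the sublevel set of \<xi> at \<theta> the acquisition is flat, so there the
  regularized objective is just \<open>- l * \<xi> x\<close>, and maximizing it means minimizing
  \<xi>. A maximizer in that set competes with \<open>xs\<close>, which lies in the set too, so it
  must be a global minimizer of \<xi>; uniqueness does the rest.\<close>

theorem proposition1:
  fixes \<alpha> \<xi> :: "real ^ 'n \<Rightarrow> real"
    and xs :: "real ^ 'n"
    and \<theta> :: real
  assumes "unique_minimizer_on search_space \<xi> xs"
    and "\<And>x. x \<in> search_space \<Longrightarrow> \<xi> x \<le> \<theta> \<Longrightarrow> \<alpha> x = 0"
  shows "\<forall>l>0. \<forall>x. maximizer_on search_space (acq_ER \<alpha> \<xi> l) x \<longrightarrow> \<xi> x > \<theta> \<or> x = xs"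
  unfolding disj_imp
proof (intro allI impI)
  fix l :: real and x :: "real ^ 'n"
  assume l: "0 < l" and max: "maximizer_on search_space (acq_ER \<alpha> \<xi> l) x"
    and "\<not> \<theta> < \<xi> x"
  then have le_\<theta>: "\<xi> x \<le> \<theta>" by simp
  have x: "x \<in> search_space" and xs: "xs \<in> search_space"
    and min: "\<And>y. y \<in> search_space \<Longrightarrow> \<xi> xs \<le> \<xi> y"
    using max assms(1)
    by (auto simp: maximizer_on_def unique_minimizer_on_def is_arg_min_linorder)
  \<comment> \<open>The point \<open>xs\<close> inherits the threshold from \<open>x\<close>: \<xi>
    xs \<le> \<xi> x \<le> \<theta>.\<close>
  have "\<alpha> x = 0" "\<alpha> xs = 0"
    using assms(2) x xs le_\<theta> min[OF x] by auto
  \<comment> \<open>Maximality of \<open>x\<close> tested against \<open>xs\<close>, where only the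
    penalty terms survive.\<close>
  then have "l * \<xi> x \<le> l * \<xi> xs"
    using max xs by (force simp: maximizer_on_def acq_ER_def)
  then have "\<xi> x \<le> \<xi> xs" using l by simp
  then have "is_arg_min \<xi> (\<lambda>y. y \<in> search_space) x"
    using x min by (force simp: is_arg_min_linorder)
  then show "x = xs" using assms(1) by (simp add: unique_minimizer_on_def)
qed

end
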